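(* Let $T:\mathcal H\to\mathcal H$ be a non-expansive operator on a real Hilbert space with $\mathrm{fix}\,T\neq\emptyset$, let $\lambda_k\in(0,1]$, $\varepsilon_k\in\mathcal H$, and let $(z_k)_{k\in\mathbb N}$ be generated from $z_0\in\mathcal H$ by $z_{k+1}=z_k+\lambda_k(Tz_k+\varepsilon_k-z_k)$. Suppose that $$0<\inf_{k\in\mathbb N}\lambda_k\le\sup_{k\in\mathbb N}\lambda_k<1\quad\text{and}\quad \sum_{k\in\mathbb N}(k+1)\|\varepsilon_k\|<+\infty .$$ Then, with $C_1=\nu_1\sum_{j\in\mathbb N}\lambda_j\|\varepsilon_j\|+\nu_2\overline\tau\sum_{\ell\in\mathbb N}(\ell+1)\|\varepsilon_\ell\|$, one has $C_1<+\infty$ and, for all $k\in\mathbb N$, $$\|e_k\|\le\sqrt{\frac{d_0^2+C_1}{\underline\tau\,(k+1)}} .$$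
   Context: $\mathbb N$ is the set of non-negative integers. $T$ is non-expansive if $\|Tx-Ty\|\le\|x-y\|$ for all $x,y$; $\mathrm{fix}\,T=\{z: z=Tz\}$. Notation: $T_{\lambda_k}=\lambda_kT+(1-\lambda_k)\mathrm{Id}$; $e_k=(\mathrm{Id}-T)z_k$; $\tau_k=\lambda_k(1-\lambda_k)$, $\underline\tau=\inf_k\tau_k$, $\overline\tau=\sup_k\tau_k$; $d_0=\inf_{z\in\mathrm{fix}\,T}\|z_0-z\|$; $z^\star\in\mathrm{fix}\,T$ is the point with $\|z_0-z^\star\|=d_0$; $\nu_1=2\sup_{k}\|T_{\lambda_k}z_k-z^\star\|+\sup_k\lambda_k\|\varepsilon_k\|$; $\nu_2=2\sup_k\|e_k-e_{k+1}\|$. *)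

theory Defs
  imports "HOL-Analysis.Analysis"
begin

definition nonexpansive :: "('a::real_normed_vector \<Rightarrow> 'a) \<Rightarrow> bool" where
  "nonexpansive T \<longleftrightarrow> (\<forall>x y. norm (T x - T y) \<le> norm (x - y))"

definition fixed_points :: "('a \<Rightarrow> 'a) \<Rightarrow> 'a set" where
  "fixed_points T = {z. z = T z}"

definition relaxed :: "('a::real_vector \<Rightarrow> 'a) \<Rightarrow> real \<Rightarrow> 'a \<Rightarrow> 'a" where
  "relaxed T l x = l *\<^sub>R T x + (1 - l) *\<^sub>R x"

definition residual :: "('a::real_vector \<Rightarrow> 'a) \<Rightarrow> (nat \<Rightarrow> 'a) \<Rightarrow> nat \<Rightarrow> 'a" where
  "residual T z k = z k - T (z k)"

definition tau :: "(nat \<Rightarrow> real) \<Rightarrow> nat \<Rightarrow> real" where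
  "tau lam k = lam k * (1 - lam k)"

definition tau_inf :: "(nat \<Rightarrow> real) \<Rightarrow> real" where
  "tau_inf lam = (INF k. tau lam k)"

definition tau_sup :: "(nat \<Rightarrow> real) \<Rightarrow> real" where
  "tau_sup lam = (SUP k. tau lam k)"

definition dist_fix :: "('a::real_normed_vector \<Rightarrow> 'a) \<Rightarrow> 'a \<Rightarrow> real" where
  "dist_fix T z0 = (INF z\<in>fixed_points T. norm (z0 - z))"

text \<open>
  The description below is proper for a nonexpansive T on a Hilbert space with a fixed point:
  the fixed-point set is then closed and convex, so the nearest point exists and is unique.
\<close>

definition proj_fix :: "('a::real_normed_vector \<Rightarrow> 'a) \<Rightarrow> 'a \<Rightarrow> 'a" where
  "proj_fix T z0 = (THE z. z \<in> fixed_points T \<and> norm (z0 - z) = dist_fix T z0)"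

text \<open>
  The suprema and series below are taken in \<^typ>\<open>ennreal\<close>, so that infinite values are
  represented as such and finiteness of \<open>C1\<close> is a genuine assertion.
\<close>

definition nu1 ::
  "('a::real_normed_vector \<Rightarrow> 'a) \<Rightarrow> (nat \<Rightarrow> real) \<Rightarrow> (nat \<Rightarrow> 'a) \<Rightarrow> (nat \<Rightarrow> 'a) \<Rightarrow> ennreal" where
  "nu1 T lam \<epsilon> z =
     2 * (SUP k. ennreal (norm (relaxed T (lam k) (z k) - proj_fix T (z 0))))
     + (SUP k. ennreal (lam k * norm (\<epsilon> k)))"

definition nu2 :: "('a::real_normed_vector \<Rightarrow> 'a) \<Rightarrow> (nat \<Rightarrow> 'a) \<Rightarrow> ennreal" where
  "nu2 T z = 2 * (SUP k. ennreal (norm (residual T z k - residual T z (k + 1))))"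

definition C1 ::
  "('a::real_normed_vector \<Rightarrow> 'a) \<Rightarrow> (nat \<Rightarrow> real) \<Rightarrow> (nat \<Rightarrow> 'a) \<Rightarrow> (nat \<Rightarrow> 'a) \<Rightarrow> ennreal" where
  "C1 T lam \<epsilon> z =
     nu1 T lam \<epsilon> z * (\<Sum>j. ennreal (lam j * norm (\<epsilon> j)))
     + nu2 T z * ennreal (tau_sup lam) * (\<Sum>l. ennreal (real (l + 1) * norm (\<epsilon> l)))"

end

theory Submission
  imports Defs
begin

text \<open>
  Write \<open>e k\<close> for the residual \<open>z k - T (z k)\<close>, \<open>\<tau> k = lam k * (1 - lam k)\<close>, and let \<open>p\<close> be the
  fixed point of \<open>T\<close> closest to \<open>z 0\<close>.  The rate comes from playing two one-step estimates
  against each other.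

  \<^item> \<^emph>\<open>Energy.\<close>  A relaxed step towards \<open>T x\<close> brings \<open>\<parallel>x - p\<parallel>\<^sup>2\<close> down by at least
    \<open>\<tau> \<parallel>x - T x\<parallel>\<^sup>2\<close> (\<open>relaxed_step_decrease\<close>), and the error \<open>\<epsilon> k\<close> gives back at most
    \<open>\<nu>\<^sub>1 lam k \<parallel>\<epsilon> k\<parallel>\<close>.  Telescoping bounds \<open>\<Sum>j\<le>k. \<tau> j \<parallel>e j\<parallel>\<^sup>2\<close> by \<open>d\<^sub>0\<^sup>2\<close> plus the first part of
    \<open>C\<^sub>1\<close>, uniformly in \<open>k\<close> (\<open>weighted_residual_sum_le\<close>).

  \<^item> \<^emph>\<open>Near-monotonicity.\<close>  Without errors \<open>\<parallel>e k\<parallel>\<close> is non-increasing; with them \<open>\<parallel>e k\<parallel>\<^sup>2\<close> grows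
    by at most \<open>\<nu>\<^sub>2 \<parallel>\<epsilon> k\<parallel>\<close> in one step (\<open>residual_step_increase\<close>).

  If the residuals were non-increasing, \<open>(\<Sum>j\<le>k. \<tau> j) \<parallel>e k\<parallel>\<^sup>2\<close> would be at most the energy sum, and
  its left factor is at least \<open>(k + 1)\<close> times the infimum of \<open>\<tau>\<close>.  In general one must pay for the
  possible growth: the increase at step \<open>l\<close> is charged once for each of the \<open>l + 1\<close> indices
  \<open>j \<le> l\<close>, each with weight \<open>\<tau> j\<close> (\<open>weighted_sum_last_le\<close>).  This is the origin of the factor
  \<open>l + 1\<close> in the summability hypothesis and in the second part of \<open>C\<^sub>1\<close>.

  That \<open>p\<close> exists and is unique is the projection theorem for closed convex sets
  (\<open>nearest_point_exists_unique\<close>).  It, the convexity of the fixed-point set and the energy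
  estimate all rest on one identity for the squared norm of a convex combination
  (\<open>norm_convex_combination_sq\<close>).
\<close>

section \<open>Nearest points of closed convex sets\<close>

text \<open>
  The exact defect in the convexity of the squared norm; for \<open>u = 1/2\<close> this is the parallelogram law.
\<close>

lemma norm_convex_combination_sq:
  fixes a b :: "'a::real_inner"
  shows "(norm ((1 - u) *\<^sub>R a + u *\<^sub>R b))\<^sup>2
    = (1 - u) * (norm a)\<^sup>2 + u * (norm b)\<^sup>2 - u * (1 - u) * (norm (a - b))\<^sup>2"
  unfolding power2_norm_eq_inner
  by (simp add: inner_simps inner_commute[of b a]) (simp add: algebra_simps)

text \<open>
  The midpoint of two points of \<open>S\<close> stays in \<open>S\<close>, so it is no closer to \<open>x\<close> than the distance \<open>d\<close>.
  By the parallelogram law, two almost nearest points are therefore close to each other: this makes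
  minimizing sequences converge and minimizers unique.
\<close>

lemma convex_near_minimizers_close:
  fixes x :: "'a::real_inner"
  assumes "convex S" "y \<in> S" "y' \<in> S" "0 \<le> d" "\<And>s. s \<in> S \<Longrightarrow> d \<le> norm (x - s)"
  shows "(norm (y - y'))\<^sup>2 \<le> 2 * ((norm (x - y))\<^sup>2 - d\<^sup>2) + 2 * ((norm (x - y'))\<^sup>2 - d\<^sup>2)"
proof -
  have "(1/2) *\<^sub>R y + (1/2) *\<^sub>R y' \<in> S"
    using assms(1-3) by (intro convexD) auto
  then have "d \<le> norm (x - ((1/2) *\<^sub>R y + (1/2) *\<^sub>R y'))"
    by (rule assms(5))
  moreover have "x - ((1/2) *\<^sub>R y + (1/2) *\<^sub>R y')
      = (1 - 1/2) *\<^sub>R (x - y) + (1/2::real) *\<^sub>R (x - y')"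
    using scaleR_half_double[of x] by (simp add: scaleR_diff_right scaleR_add_right)
  ultimately have "d \<le> norm ((1 - 1/2) *\<^sub>R (x - y) + (1/2::real) *\<^sub>R (x - y'))"
    by simp
  then have "d\<^sup>2 \<le> (norm ((1 - 1/2) *\<^sub>R (x - y) + (1/2::real) *\<^sub>R (x - y')))\<^sup>2"
    using \<open>0 \<le> d\<close> by (rule power_mono)
  also have "\<dots> = (norm (x - y))\<^sup>2 / 2 + (norm (x - y'))\<^sup>2 / 2 - (norm (y - y'))\<^sup>2 / 4"
    unfolding norm_convex_combination_sq by (simp add: norm_minus_commute)
  finally show ?thesis
    by simp
qed

lemma nearest_point_exists_unique:
  fixes x :: "'a::{real_inner, complete_space}"
  assumes "closed S" "convex S" "S \<noteq> {}"
  shows "\<exists>!y. y \<in> S \<and> norm (x - y) = (INF s\<in>S. norm (x - s))"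
proof -
  define d where "d = (INF s\<in>S. norm (x - s))"
  have bdd: "bdd_below ((\<lambda>s. norm (x - s)) ` S)"
    by (intro bdd_belowI[of _ 0]) auto
  have lower: "d \<le> norm (x - s)" if "s \<in> S" for s
    unfolding d_def using bdd that by (rule cINF_lower)
  have d0: "0 \<le> d"
    unfolding d_def using assms(3) by (intro cINF_greatest) auto
  have "\<exists>s\<in>S. norm (x - s) < d + 1 / real (Suc n)" for n
    using cINF_less_iff[OF assms(3) bdd, of "d + 1 / real (Suc n)"] unfolding d_def by simp
  then obtain y where yS: "\<And>n. y n \<in> S" and y: "\<And>n. norm (x - y n) < d + 1 / real (Suc n)"
    by metis
  have "(\<lambda>n. d + 1 / real (Suc n)) \<longlonglongrightarrow> d + 0"
    using LIMSEQ_inverse_real_of_nat by (intro tendsto_intros) (simp add: inverse_eq_divide)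
  then have upper_lim: "(\<lambda>n. d + 1 / real (Suc n)) \<longlonglongrightarrow> d"
    by simp
  have "(\<lambda>n. norm (x - y n)) \<longlonglongrightarrow> d"
    by (rule tendsto_sandwich[OF _ _ tendsto_const upper_lim])
      (use lower[OF yS] y in \<open>blast intro: always_eventually less_imp_le\<close>)+
  then have "(\<lambda>n. (norm (x - y n))\<^sup>2 - d\<^sup>2) \<longlonglongrightarrow> d\<^sup>2 - d\<^sup>2"
    by (intro tendsto_intros)
  then have sq: "(\<lambda>n. (norm (x - y n))\<^sup>2 - d\<^sup>2) \<longlonglongrightarrow> 0"
    by simp
  have "Cauchy y"
  proof (rule CauchyI)
    fix e :: real assume "0 < e"
    then have "eventually (\<lambda>n. (norm (x - y n))\<^sup>2 - d\<^sup>2 < e\<^sup>2 / 4) sequentially"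
      using sq by (intro order_tendstoD) auto
    then obtain N where N: "\<And>n. n \<ge> N \<Longrightarrow> (norm (x - y n))\<^sup>2 - d\<^sup>2 < e\<^sup>2 / 4"
      unfolding eventually_sequentially by blast
    have "norm (y m - y n) < e" if "m \<ge> N" "n \<ge> N" for m n
    proof (rule power2_less_imp_less)
      show "(norm (y m - y n))\<^sup>2 < e\<^sup>2"
        using convex_near_minimizers_close[OF assms(2) yS[of m] yS[of n] d0 lower]
          N[OF that(1)] N[OF that(2)]
        by simp
    qed (use \<open>0 < e\<close> in simp)
    then show "\<exists>M. \<forall>m\<ge>M. \<forall>n\<ge>M. norm (y m - y n) < e"
      by blast
  qed
  then obtain l where l: "y \<longlonglongrightarrow> l"
    using Cauchy_convergent convergentD by blast
  have "l \<in> S"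
    using assms(1) yS l by (rule closed_sequentially)
  moreover have "norm (x - l) = d"
  proof (rule LIMSEQ_unique)
    show "(\<lambda>n. norm (x - y n)) \<longlonglongrightarrow> norm (x - l)"
      using l by (intro tendsto_intros)
  qed fact
  ultimately show ?thesis
  proof (intro ex1I[of _ l], fold d_def)
    fix q assume "q \<in> S \<and> norm (x - q) = d"
    then have "(norm (q - l))\<^sup>2 \<le> 0"
      using convex_near_minimizers_close[OF assms(2) _ \<open>l \<in> S\<close> d0 lower, of q] \<open>norm (x - l) = d\<close>
      by simp
    then show "q = l"
      by simp
  qed simp
qed

section \<open>Fixed points of nonexpansive operators\<close>

lemma nonexpansiveD: "nonexpansive T \<Longrightarrow> norm (T x - T y) \<le> norm (x - y)"
  by (simp add: nonexpansive_def)

lemma nonexpansive_fixedD: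
  assumes "nonexpansive T" "p \<in> fixed_points T"
  shows "norm (T x - p) \<le> norm (x - p)"
proof -
  have "T p = p"
    using assms(2) unfolding fixed_points_def by auto
  then show ?thesis
    using nonexpansiveD[OF assms(1), of x p] by simp
qed

lemma closed_fixed_points:
  fixes T :: "'a::real_normed_vector \<Rightarrow> 'a"
  assumes "nonexpansive T"
  shows "closed (fixed_points T)"
proof -
  have "1-lipschitz_on UNIV T"
    using nonexpansiveD[OF assms] by (intro lipschitz_onI) (auto simp: dist_norm)
  then have "continuous_on UNIV T"
    by (rule lipschitz_on_continuous_on)
  then show ?thesis
    unfolding fixed_points_def by (intro closed_Collect_eq continuous_on_id)
qed

text \<open>
  If \<open>m\<close> divides the segment between the fixed points \<open>p\<close> and \<open>q\<close>, then \<open>T m\<close> is at most as far from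
  \<open>p\<close> and from \<open>q\<close> as \<open>m\<close> is.  In an inner product space the two balls described by this
  meet only in \<open>m\<close>.
\<close>

lemma convex_fixed_points:
  fixes T :: "'a::real_inner \<Rightarrow> 'a"
  assumes "nonexpansive T"
  shows "convex (fixed_points T)"
  unfolding convex_alt
proof (intro ballI allI impI)
  fix p q and u :: real
  assume p: "p \<in> fixed_points T" and q: "q \<in> fixed_points T" and u: "0 \<le> u \<and> u \<le> 1"
  define m where "m = (1 - u) *\<^sub>R p + u *\<^sub>R q"
  have mp: "m - p = u *\<^sub>R (q - p)" and mq: "m - q = (1 - u) *\<^sub>R (p - q)"
    unfolding m_def by (simp_all add: algebra_simps)
  have "norm (T m - p) \<le> u * norm (p - q)"
    using nonexpansive_fixedD[OF assms p, of m] u by (simp add: mp norm_minus_commute)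
  then have P: "(norm (T m - p))\<^sup>2 \<le> (u * norm (p - q))\<^sup>2"
    by (intro power_mono) auto
  have "norm (T m - q) \<le> (1 - u) * norm (p - q)"
    using nonexpansive_fixedD[OF assms q, of m] u by (simp add: mq)
  then have Q: "(norm (T m - q))\<^sup>2 \<le> ((1 - u) * norm (p - q))\<^sup>2"
    by (intro power_mono) auto
  have "T m - m = (1 - u) *\<^sub>R (T m - p) + u *\<^sub>R (T m - q)"
    unfolding m_def by (simp add: algebra_simps)
  then have "(norm (T m - m))\<^sup>2 = (1 - u) * (norm (T m - p))\<^sup>2 + u * (norm (T m - q))\<^sup>2
      - u * (1 - u) * (norm (p - q))\<^sup>2"
    by (simp only: norm_convex_combination_sq) (simp add: norm_minus_commute)
  also have "\<dots> \<le> (1 - u) * (u * norm (p - q))\<^sup>2 + u * ((1 - u) * norm (p - q))\<^sup>2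
      - u * (1 - u) * (norm (p - q))\<^sup>2"
    using u P Q by (intro diff_right_mono add_mono mult_left_mono) auto
  also have "\<dots> = 0"
    by (simp add: power2_eq_square algebra_simps)
  finally show "(1 - u) *\<^sub>R p + u *\<^sub>R q \<in> fixed_points T"
    unfolding m_def[symmetric] fixed_points_def by simp
qed

lemma proj_fix_nearest:
  fixes T :: "'a::{real_inner, complete_space} \<Rightarrow> 'a"
  assumes "nonexpansive T" "fixed_points T \<noteq> {}"
  shows "proj_fix T x \<in> fixed_points T" "norm (x - proj_fix T x) = dist_fix T x"
proof -
  have "\<exists>!y. y \<in> fixed_points T \<and> norm (x - y) = dist_fix T x"
    unfolding dist_fix_def
    by (intro nearest_point_exists_unique closed_fixed_points convex_fixed_points assms)
  from theI'[OF this] show "proj_fix T x \<in> fixed_points T" "norm (x - proj_fix T x) = dist_fix T x"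
    unfolding proj_fix_def by blast+
qed

section \<open>One inexact step\<close>

text \<open>
  Since \<open>\<parallel>T x - p\<parallel> \<le> \<parallel>x - p\<parallel>\<close>, the convexity defect of the squared norm is the whole decrease.
\<close>

lemma relaxed_step_decrease:
  fixes T :: "'a::real_inner \<Rightarrow> 'a"
  assumes "nonexpansive T" "p \<in> fixed_points T" "0 \<le> l" "l \<le> 1"
  shows "(norm (relaxed T l x - p))\<^sup>2 \<le> (norm (x - p))\<^sup>2 - l * (1 - l) * (norm (x - T x))\<^sup>2"
proof -
  have "relaxed T l x - p = (1 - l) *\<^sub>R (x - p) + l *\<^sub>R (T x - p)"
    unfolding relaxed_def by (simp add: algebra_simps)
  then have "(norm (relaxed T l x - p))\<^sup>2 = (1 - l) * (norm (x - p))\<^sup>2 + l * (norm (T x - p))\<^sup>2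
      - l * (1 - l) * (norm (x - T x))\<^sup>2"
    by (simp only: norm_convex_combination_sq) simp
  moreover have "l * (norm (T x - p))\<^sup>2 \<le> l * (norm (x - p))\<^sup>2"
    using nonexpansive_fixedD[OF assms(1,2)] assms(3) by (intro mult_left_mono power_mono) auto
  ultimately show ?thesis
    by (simp add: algebra_simps)
qed

lemma relaxed_step_nonexpansive:
  fixes T :: "'a::real_inner \<Rightarrow> 'a"
  assumes "nonexpansive T" "p \<in> fixed_points T" "0 \<le> l" "l \<le> 1"
  shows "norm (relaxed T l x - p) \<le> norm (x - p)"
proof (rule power2_le_imp_le)
  have "0 \<le> l * (1 - l) * (norm (x - T x))\<^sup>2"
    using assms by simp
  then show "(norm (relaxed T l x - p))\<^sup>2 \<le> (norm (x - p))\<^sup>2"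
    using relaxed_step_decrease[OF assms, of x] by linarith
qed simp

lemma inexact_step_eq_relaxed:
  "x + l *\<^sub>R (T x + \<epsilon> - x) - p = (relaxed T l x - p) + l *\<^sub>R \<epsilon>"
  unfolding relaxed_def by (simp add: algebra_simps)

lemma inexact_step_distance:
  fixes T :: "'a::real_inner \<Rightarrow> 'a"
  assumes "nonexpansive T" "p \<in> fixed_points T" "0 \<le> l" "l \<le> 1"
  shows "norm (x + l *\<^sub>R (T x + \<epsilon> - x) - p) \<le> norm (x - p) + l * norm \<epsilon>"
proof -
  have "norm (relaxed T l x - p + l *\<^sub>R \<epsilon>) \<le> norm (relaxed T l x - p) + norm (l *\<^sub>R \<epsilon>)"
    by (rule norm_triangle_ineq)
  then show ?thesis
    unfolding inexact_step_eq_relaxed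
    using relaxed_step_nonexpansive[OF assms, of x] assms(3) by simp
qed

text \<open>
  If \<open>r\<close> is the distance to \<open>p\<close> after the exact relaxed step and \<open>a = l \<parallel>\<epsilon>\<parallel>\<close>, the error raises \<open>r\<^sup>2\<close> to
  at most \<open>(r + a)\<^sup>2 = r\<^sup>2 + (2 r + a) a\<close>.  This is where the form of \<open>\<nu>\<^sub>1\<close> comes from.
\<close>

lemma inexact_step_decrease:
  fixes T :: "'a::real_inner \<Rightarrow> 'a"
  assumes "nonexpansive T" "p \<in> fixed_points T" "0 \<le> l" "l \<le> 1"
    and N: "2 * norm (relaxed T l x - p) + l * norm \<epsilon> \<le> N"
  shows "(norm (x + l *\<^sub>R (T x + \<epsilon> - x) - p))\<^sup>2
    \<le> (norm (x - p))\<^sup>2 - l * (1 - l) * (norm (x - T x))\<^sup>2 + N * (l * norm \<epsilon>)"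
proof -
  define r where "r = norm (relaxed T l x - p)"
  have "norm (relaxed T l x - p + l *\<^sub>R \<epsilon>) \<le> r + l * norm \<epsilon>"
    using norm_triangle_ineq[of "relaxed T l x - p" "l *\<^sub>R \<epsilon>"] assms(3) by (simp add: r_def)
  then have "(norm (x + l *\<^sub>R (T x + \<epsilon> - x) - p))\<^sup>2 \<le> (r + l * norm \<epsilon>)\<^sup>2"
    unfolding inexact_step_eq_relaxed by (rule power_mono) simp
  also have "\<dots> = r\<^sup>2 + (2 * r + l * norm \<epsilon>) * (l * norm \<epsilon>)"
    by (simp add: power2_eq_square algebra_simps)
  also have "\<dots> \<le> r\<^sup>2 + N * (l * norm \<epsilon>)"
    using N assms(3) by (intro add_left_mono mult_right_mono) (auto simp: r_def)
  finally show ?thesis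
    using relaxed_step_decrease[OF assms(1-4), of x] unfolding r_def by linarith
qed

text \<open>
  Nonexpansiveness of \<open>T\<close> makes half of \<open>Id - T\<close> firmly nonexpansive.
\<close>

lemma residual_map_cocoercive:
  fixes T :: "'a::real_inner \<Rightarrow> 'a"
  assumes "nonexpansive T"
  shows "(norm ((x - T x) - (y - T y)))\<^sup>2 \<le> 2 * inner ((x - T x) - (y - T y)) (x - y)"
proof -
  define D where "D = (x - T x) - (y - T y)"
  have "(norm (T x - T y))\<^sup>2 \<le> (norm (x - y))\<^sup>2"
    using nonexpansiveD[OF assms] by (intro power_mono) auto
  moreover have "T x - T y = (x - y) - D"
    by (simp add: D_def)
  moreover have "2 * inner D (x - y) = (norm (x - y))\<^sup>2 + (norm D)\<^sup>2 - (norm ((x - y) - D))\<^sup>2"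
    using dot_norm_neg[of "x - y" D] by (simp add: inner_commute[of D])
  ultimately show ?thesis
    unfolding D_def[symmetric] by simp
qed

text \<open>
  The displacement of a step is \<open>x - y = l (e - \<epsilon>)\<close> with \<open>e = x - T x\<close>, so cocoercivity bounds the
  inner product of \<open>e\<close> with the change \<open>D\<close> of the residual from below by \<open>\<parallel>D\<parallel>\<^sup>2 / (2 l)\<close> up to an
  error term.  For \<open>l \<le> 1\<close> this absorbs the \<open>\<parallel>D\<parallel>\<^sup>2\<close> in the expansion of \<open>\<parallel>e - D\<parallel>\<^sup>2\<close>.
\<close>

lemma residual_step_increase:
  fixes T :: "'a::real_inner \<Rightarrow> 'a"
  assumes "nonexpansive T" "0 < l" "l \<le> 1" and y: "y = x + l *\<^sub>R (T x + \<epsilon> - x)"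
  shows "(norm (y - T y))\<^sup>2 \<le> (norm (x - T x))\<^sup>2 + 2 * norm ((x - T x) - (y - T y)) * norm \<epsilon>"
proof -
  define e where "e = x - T x"
  define D where "D = e - (y - T y)"
  have xy: "x - y = l *\<^sub>R (e - \<epsilon>)"
    unfolding y e_def by (simp add: algebra_simps)
  have "l * (norm D)\<^sup>2 \<le> (norm D)\<^sup>2"
    using assms by (simp add: mult_left_le_one_le)
  also have "\<dots> \<le> 2 * inner D (x - y)"
    using residual_map_cocoercive[OF assms(1), of x y] unfolding D_def e_def .
  also have "\<dots> = l * (2 * inner D e - 2 * inner D \<epsilon>)"
    by (simp add: xy inner_diff_right algebra_simps)
  finally have "(norm D)\<^sup>2 \<le> 2 * inner D e - 2 * inner D \<epsilon>"
    using \<open>0 < l\<close> by simp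
  moreover have "(norm (e - D))\<^sup>2 = (norm e)\<^sup>2 - 2 * inner D e + (norm D)\<^sup>2"
    using dot_norm_neg[of e D] by (simp add: inner_commute[of D])
  moreover have "- inner D \<epsilon> \<le> norm D * norm \<epsilon>"
    using Cauchy_Schwarz_ineq2[of D \<epsilon>] by linarith
  moreover have "e - D = y - T y"
    by (simp add: D_def)
  ultimately have "(norm (y - T y))\<^sup>2 \<le> (norm e)\<^sup>2 + 2 * norm D * norm \<epsilon>"
    by simp
  then show ?thesis
    unfolding D_def e_def .
qed

section \<open>Summing up the steps\<close>

text \<open>
  Passing from \<open>E k\<close> to \<open>E (Suc k)\<close> may cost \<open>b k\<close> for each of the weights collected so far, while the
  new weight enters on both sides with the same value \<open>E (Suc k)\<close>.
\<close>

lemma weighted_sum_last_le: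
  fixes w E b :: "nat \<Rightarrow> real"
  assumes "\<And>k. 0 \<le> w k" "\<And>k. E (Suc k) \<le> E k + b k"
  shows "(\<Sum>j\<le>k. w j) * E k \<le> (\<Sum>j\<le>k. w j * E j) + (\<Sum>l<k. (\<Sum>j\<le>l. w j) * b l)"
proof (induction k)
  case 0
  show ?case by simp
next
  case (Suc k)
  have "(\<Sum>j\<le>k. w j) * E (Suc k) \<le> (\<Sum>j\<le>k. w j) * (E k + b k)"
    using assms by (intro mult_left_mono sum_nonneg) auto
  with Suc.IH show ?case
    by (simp add: algebra_simps)
qed

lemma weighted_residual_sum_le:
  fixes T :: "'a::real_inner \<Rightarrow> 'a"
  assumes "nonexpansive T" "p \<in> fixed_points T" "\<And>k. 0 < lam k \<and> lam k \<le> 1"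
    and "\<And>k. z (k + 1) = z k + lam k *\<^sub>R (T (z k) + \<epsilon> k - z k)"
    and "\<And>k. 2 * norm (relaxed T (lam k) (z k) - p) + lam k * norm (\<epsilon> k) \<le> N"
  shows "(\<Sum>j<k. tau lam j * (norm (residual T z j))\<^sup>2)
    \<le> (norm (z 0 - p))\<^sup>2 + N * (\<Sum>j<k. lam j * norm (\<epsilon> j))"
proof -
  have step: "(norm (z (Suc j) - p))\<^sup>2
      \<le> (norm (z j - p))\<^sup>2 - tau lam j * (norm (residual T z j))\<^sup>2 + N * (lam j * norm (\<epsilon> j))" for j
    using inexact_step_decrease[OF assms(1,2) _ _ assms(5), of j] assms(3)[of j] assms(4)[of j]
    by (simp add: tau_def residual_def)
  have "(norm (z k - p))\<^sup>2 + (\<Sum>j<k. tau lam j * (norm (residual T z j))\<^sup>2)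
      \<le> (norm (z 0 - p))\<^sup>2 + N * (\<Sum>j<k. lam j * norm (\<epsilon> j))"
  proof (induction k)
    case 0
    show ?case by simp
  next
    case (Suc k)
    with step[of k] show ?case
      by (simp add: algebra_simps)
  qed
  then show ?thesis
    using zero_le_power2[of "norm (z k - p)"] by linarith
qed

text \<open>
  An exact relaxed step does not move away from \<open>p\<close>, so only the errors can, and they are summable.
\<close>

lemma iterates_bounded:
  fixes T :: "'a::real_inner \<Rightarrow> 'a"
  assumes "nonexpansive T" "p \<in> fixed_points T" "\<And>k. 0 < lam k \<and> lam k \<le> 1"
    and "\<And>k. z (k + 1) = z k + lam k *\<^sub>R (T (z k) + \<epsilon> k - z k)"
    and "summable (\<lambda>k. lam k * norm (\<epsilon> k))"
  shows "norm (z k - p) \<le> norm (z 0 - p) + (\<Sum>j. lam j * norm (\<epsilon> j))"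
proof -
  have "norm (z k - p) \<le> norm (z 0 - p) + (\<Sum>j<k. lam j * norm (\<epsilon> j))"
  proof (induction k)
    case 0
    show ?case by simp
  next
    case (Suc k)
    with inexact_step_distance[OF assms(1,2), of "lam k" "z k" "\<epsilon> k"] assms(3)[of k] assms(4)[of k]
    show ?case by simp
  qed
  also have "(\<Sum>j<k. lam j * norm (\<epsilon> j)) \<le> (\<Sum>j. lam j * norm (\<epsilon> j))"
    using assms(3) by (intro sum_le_suminf assms(5)) (auto simp: less_imp_le)
  finally show ?thesis by simp
qed

text \<open>
  The estimate uses \<open>\<nu>\<^sub>1\<close>, \<open>\<nu>\<^sub>2\<close> and the extrema of \<open>\<tau>\<close> only as bounds.  Stating it for arbitrary
  real bounds separates it from the question whether these suprema are finite.
\<close>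

lemma residual_rate:
  fixes T :: "'a::real_inner \<Rightarrow> 'a"
  assumes "nonexpansive T" "p \<in> fixed_points T" and lam: "\<And>k. 0 < lam k \<and> lam k \<le> 1"
    and z: "\<And>k. z (k + 1) = z k + lam k *\<^sub>R (T (z k) + \<epsilon> k - z k)"
    and sum1: "summable (\<lambda>k. lam k * norm (\<epsilon> k))"
    and sum2: "summable (\<lambda>k. real (k + 1) * norm (\<epsilon> k))"
    and N1: "\<And>k. 2 * norm (relaxed T (lam k) (z k) - p) + lam k * norm (\<epsilon> k) \<le> N1"
    and N2: "\<And>k. 2 * norm (residual T z k - residual T z (k + 1)) \<le> N2"
    and t: "0 < t" "\<And>k. t \<le> tau lam k" and t': "\<And>k. tau lam k \<le> t'"
  shows "norm (residual T z k)
    \<le> sqrt (((norm (z 0 - p))\<^sup>2 + (N1 * (\<Sum>j. lam j * norm (\<epsilon> j))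
        + N2 * t' * (\<Sum>l. real (l + 1) * norm (\<epsilon> l)))) / (t * real (k + 1)))"
proof -
  define E where "E = (\<lambda>k. (norm (residual T z k))\<^sup>2)"
  have tau0: "0 \<le> tau lam k" for k
    using t(1) t(2)[of k] by simp
  have N1_0: "0 \<le> N1"
    by (rule order_trans[OF _ N1[of 0]]) (use lam[of 0] in simp)
  have N2_0: "0 \<le> N2"
    by (rule order_trans[OF _ N2[of 0]]) simp
  have t'0: "0 \<le> t'"
    using tau0[of 0] t'[of 0] by simp
  have "E (Suc k) \<le> E k + N2 * norm (\<epsilon> k)" for k
  proof -
    have "E (Suc k) \<le> E k + 2 * norm (residual T z k - residual T z (k + 1)) * norm (\<epsilon> k)"
      using residual_step_increase[OF assms(1) _ _ z, of k] lam[of k]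
      by (simp add: E_def residual_def)
    also have "\<dots> \<le> E k + N2 * norm (\<epsilon> k)"
      using N2[of k] by (intro add_left_mono mult_right_mono) auto
    finally show ?thesis .
  qed
  then have "(\<Sum>j\<le>k. tau lam j) * E k
      \<le> (\<Sum>j\<le>k. tau lam j * E j) + (\<Sum>l<k. (\<Sum>j\<le>l. tau lam j) * (N2 * norm (\<epsilon> l)))"
    using tau0 by (intro weighted_sum_last_le)
  moreover have "t * real (k + 1) * E k \<le> (\<Sum>j\<le>k. tau lam j) * E k"
    using sum_mono[of "{..k}" "\<lambda>_. t" "tau lam"] t(2)
    by (intro mult_right_mono) (auto simp: E_def algebra_simps)
  moreover have "(\<Sum>j\<le>k. tau lam j * E j)
      \<le> (norm (z 0 - p))\<^sup>2 + N1 * (\<Sum>j. lam j * norm (\<epsilon> j))"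
  proof -
    have "(\<Sum>j<Suc k. tau lam j * E j)
        \<le> (norm (z 0 - p))\<^sup>2 + N1 * (\<Sum>j<Suc k. lam j * norm (\<epsilon> j))"
      unfolding E_def by (rule weighted_residual_sum_le[where \<epsilon> = \<epsilon>]) fact+
    also have "\<dots> \<le> (norm (z 0 - p))\<^sup>2 + N1 * (\<Sum>j. lam j * norm (\<epsilon> j))"
      using lam by (intro add_left_mono mult_left_mono sum_le_suminf sum1 N1_0)
        (auto simp: less_imp_le)
    finally show ?thesis
      by (simp add: lessThan_Suc_atMost)
  qed
  moreover have "(\<Sum>l<k. (\<Sum>j\<le>l. tau lam j) * (N2 * norm (\<epsilon> l)))
      \<le> N2 * t' * (\<Sum>l. real (l + 1) * norm (\<epsilon> l))"
  proof -
    have "(\<Sum>j\<le>l. tau lam j) \<le> real (l + 1) * t'" for l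
      using sum_mono[of "{..l}" "tau lam" "\<lambda>_. t'"] t' by simp
    then have "(\<Sum>l<k. (\<Sum>j\<le>l. tau lam j) * (N2 * norm (\<epsilon> l)))
        \<le> (\<Sum>l<k. real (l + 1) * t' * (N2 * norm (\<epsilon> l)))"
      using N2_0 by (intro sum_mono mult_right_mono) auto
    also have "\<dots> = N2 * t' * (\<Sum>l<k. real (l + 1) * norm (\<epsilon> l))"
      by (simp add: sum_distrib_left mult_ac)
    also have "\<dots> \<le> N2 * t' * (\<Sum>l. real (l + 1) * norm (\<epsilon> l))"
      using N2_0 t'0 by (intro mult_left_mono sum_le_suminf sum2) auto
    finally show ?thesis .
  qed
  ultimately have "t * real (k + 1) * E k \<le> (norm (z 0 - p))\<^sup>2 + (N1 * (\<Sum>j. lam j * norm (\<epsilon> j))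
        + N2 * t' * (\<Sum>l. real (l + 1) * norm (\<epsilon> l)))"
    by linarith
  then have "E k \<le> ((norm (z 0 - p))\<^sup>2 + (N1 * (\<Sum>j. lam j * norm (\<epsilon> j))
        + N2 * t' * (\<Sum>l. real (l + 1) * norm (\<epsilon> l)))) / (t * real (k + 1))"
    using t(1) by (subst pos_le_divide_eq) (auto simp: mult_ac)
  then show ?thesis
    unfolding E_def by (rule real_le_rsqrt)
qed

section \<open>The relaxation weights and the constants\<close>

lemma tau_bounds:
  assumes "\<And>k. 0 < lam k \<and> lam k \<le> 1" "0 < (INF k. lam k)" "(SUP k. lam k) < 1"
  shows "0 < tau_inf lam" "tau_inf lam \<le> tau lam k" "tau lam k \<le> tau_sup lam"
proof -
  have range: "0 \<le> tau lam k \<and> tau lam k \<le> 1" for k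
    using assms(1)[of k] by (auto simp: tau_def intro: mult_le_one)
  have "(INF k. lam k) * (1 - (SUP k. lam k)) \<le> tau lam k" for k
    unfolding tau_def
  proof (rule mult_mono)
    show "(INF k. lam k) \<le> lam k"
      using assms(1) by (intro cINF_lower bdd_belowI[of _ 0]) (auto intro: less_imp_le)
    have "lam k \<le> (SUP k. lam k)"
      using assms(1) by (intro cSUP_upper bdd_aboveI[of _ 1]) auto
    then show "1 - (SUP k. lam k) \<le> 1 - lam k"
      by simp
  qed (use assms(1)[of k] assms(3) in auto)
  then have "(INF k. lam k) * (1 - (SUP k. lam k)) \<le> tau_inf lam"
    unfolding tau_inf_def by (intro cINF_greatest) auto
  moreover have "0 < (INF k. lam k) * (1 - (SUP k. lam k))"
    using assms(2,3) by simp
  ultimately show "0 < tau_inf lam"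
    by simp
  show "tau_inf lam \<le> tau lam k"
    unfolding tau_inf_def using range by (intro cINF_lower bdd_belowI[of _ 0]) auto
  show "tau lam k \<le> tau_sup lam"
    unfolding tau_sup_def using range by (intro cSUP_upper bdd_aboveI[of _ 1]) auto
qed

lemma SUP_ennreal_finite:
  assumes "\<And>k. f k \<le> B"
  shows "(SUP k. ennreal (f k)) < \<infinity>"
proof -
  have "(SUP k. ennreal (f k)) \<le> ennreal B"
    using assms by (intro SUP_least ennreal_leI)
  then show ?thesis
    by (simp add: le_less_trans)
qed

lemma suminf_ennreal_nonneg:
  assumes "summable f" "\<And>k. 0 \<le> f k"
  shows "(\<Sum>k. ennreal (f k)) = ennreal (\<Sum>k. f k)"
  using assms by (intro suminf_ennreal_eq summable_sums)

lemma le_enn2real: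
  assumes "ennreal x \<le> c" "c < \<infinity>"
  shows "x \<le> enn2real c"
proof (cases "0 \<le> x")
  case True
  then show ?thesis
    using enn2real_mono[OF assms(1)] assms(2) by simp
next
  case False
  then show ?thesis
    using enn2real_nonneg[of c] by linarith
qed

theorem theorem1:
  fixes T :: "'a::{real_inner, complete_space} \<Rightarrow> 'a"
    and lam :: "nat \<Rightarrow> real"
    and \<epsilon> z :: "nat \<Rightarrow> 'a"
  assumes "nonexpansive T"
    and "fixed_points T \<noteq> {}"
    and "\<And>k. 0 < lam k \<and> lam k \<le> 1"
    and "\<And>k. z (k + 1) = z k + lam k *\<^sub>R (T (z k) + \<epsilon> k - z k)"
    and "0 < (INF k. lam k)"
    and "(SUP k. lam k) < 1"
    and "summable (\<lambda>k. real (k + 1) * norm (\<epsilon> k))"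
  shows "C1 T lam \<epsilon> z < \<infinity> \<and>
    (\<forall>k. norm (residual T z k)
        \<le> sqrt (((dist_fix T (z 0))\<^sup>2 + enn2real (C1 T lam \<epsilon> z)) / (tau_inf lam * real (k + 1))))"
proof -
  define p where "p = proj_fix T (z 0)"
  have p: "p \<in> fixed_points T" and dist: "norm (z 0 - p) = dist_fix T (z 0)"
    unfolding p_def using proj_fix_nearest[OF assms(1,2)] by auto
  define S1 where "S1 = (\<Sum>j. lam j * norm (\<epsilon> j))"
  define S2 where "S2 = (\<Sum>l. real (l + 1) * norm (\<epsilon> l))"
  have lam_le: "lam k * norm (\<epsilon> k) \<le> real (k + 1) * norm (\<epsilon> k)" for k
    using assms(3)[of k] by (intro mult_right_mono) auto
  have nonneg: "0 \<le> lam k * norm (\<epsilon> k)" for k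
    using assms(3)[of k] by simp
  have sum1: "summable (\<lambda>k. lam k * norm (\<epsilon> k))"
    using lam_le nonneg by (intro summable_comparison_test[OF _ assms(7)]) auto
  have S1: "(\<Sum>j. ennreal (lam j * norm (\<epsilon> j))) = ennreal S1" and "0 \<le> S1"
    unfolding S1_def using sum1 nonneg by (auto intro: suminf_ennreal_nonneg suminf_nonneg)
  have S2: "(\<Sum>l. ennreal (real (l + 1) * norm (\<epsilon> l))) = ennreal S2" and "0 \<le> S2"
    unfolding S2_def using assms(7) by (intro suminf_ennreal_nonneg suminf_nonneg; simp)+
  \<comment> \<open>All iterates lie within \<open>B\<close> of \<open>p\<close>, so their relaxed images and residuals are bounded too.\<close>
  define B where "B = norm (z 0 - p) + S1"
  have B: "norm (z k - p) \<le> B" for k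
    unfolding B_def S1_def by (rule iterates_bounded) fact+

  have "norm (relaxed T (lam k) (z k) - p) \<le> B" for k
    using relaxed_step_nonexpansive[OF assms(1) p, of "lam k" "z k"] assms(3)[of k] B[of k] by simp
  then have "(SUP k. ennreal (norm (relaxed T (lam k) (z k) - p))) < \<infinity>"
    by (rule SUP_ennreal_finite)
  moreover have "lam k * norm (\<epsilon> k) \<le> S1" for k
    using sum_le_suminf[OF sum1, of "{k}"] nonneg by (simp add: S1_def)
  then have "(SUP k. ennreal (lam k * norm (\<epsilon> k))) < \<infinity>"
    by (rule SUP_ennreal_finite)
  ultimately have nu1: "nu1 T lam \<epsilon> z < \<infinity>"
    unfolding nu1_def p_def[symmetric] by (simp add: ennreal_mult_less_top)
  have res: "norm (residual T z k) \<le> 2 * B" for k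
    using norm_triangle_ineq4[of "z k - p" "T (z k) - p"] nonexpansive_fixedD[OF assms(1) p, of "z k"]
      B[of k] by (simp add: residual_def)
  have "norm (residual T z k - residual T z (k + 1)) \<le> 4 * B" for k
    using norm_triangle_ineq4[of "residual T z k" "residual T z (k + 1)"] res[of k] res[of "k + 1"]
    by linarith
  then have "(SUP k. ennreal (norm (residual T z k - residual T z (k + 1)))) < \<infinity>"
    by (rule SUP_ennreal_finite)
  then have nu2: "nu2 T z < \<infinity>"
    unfolding nu2_def by (simp add: ennreal_mult_less_top)

  define N1 where "N1 = enn2real (nu1 T lam \<epsilon> z)"
  define N2 where "N2 = enn2real (nu2 T z)"
  have N0: "0 \<le> N1" "0 \<le> N2"
    unfolding N1_def N2_def by simp_all
  have N1: "2 * norm (relaxed T (lam k) (z k) - p) + lam k * norm (\<epsilon> k) \<le> N1" for k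
    unfolding N1_def
  proof (rule le_enn2real[OF _ nu1])
    have "ennreal (2 * norm (relaxed T (lam k) (z k) - p) + lam k * norm (\<epsilon> k))
        = 2 * ennreal (norm (relaxed T (lam k) (z k) - p)) + ennreal (lam k * norm (\<epsilon> k))"
      using nonneg[of k] by (simp add: ennreal_plus ennreal_mult del: ennreal_plus_if)
    also have "\<dots> \<le> nu1 T lam \<epsilon> z"
      unfolding nu1_def p_def[symmetric] by (intro add_mono mult_left_mono SUP_upper) auto
    finally show "ennreal (2 * norm (relaxed T (lam k) (z k) - p) + lam k * norm (\<epsilon> k))
        \<le> nu1 T lam \<epsilon> z" .
  qed
  have N2: "2 * norm (residual T z k - residual T z (k + 1)) \<le> N2" for k
    unfolding N2_def
  proof (rule le_enn2real[OF _ nu2])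
    have "ennreal (2 * norm (residual T z k - residual T z (k + 1)))
        = 2 * ennreal (norm (residual T z k - residual T z (k + 1)))"
      by (simp add: ennreal_mult)
    also have "\<dots> \<le> nu2 T z"
      unfolding nu2_def by (intro mult_left_mono SUP_upper) auto
    finally show "ennreal (2 * norm (residual T z k - residual T z (k + 1))) \<le> nu2 T z" .
  qed
  note tau = tau_bounds[OF assms(3,5,6)]
  have tau_sup: "0 \<le> tau_sup lam"
    using tau(1) tau(2)[of 0] tau(3)[of 0] by linarith

  have "nu1 T lam \<epsilon> z = ennreal N1" "nu2 T z = ennreal N2"
    unfolding N1_def N2_def using nu1 nu2 by simp_all
  then have C1: "C1 T lam \<epsilon> z = ennreal (N1 * S1 + N2 * tau_sup lam * S2)"
    unfolding C1_def S1 S2 using N0 tau_sup \<open>0 \<le> S1\<close> \<open>0 \<le> S2\<close>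
    by (simp add: ennreal_plus ennreal_mult del: ennreal_plus_if)
  have "0 \<le> N1 * S1 + N2 * tau_sup lam * S2"
    using N0 tau_sup \<open>0 \<le> S1\<close> \<open>0 \<le> S2\<close> by simp
  then have C1_real: "enn2real (C1 T lam \<epsilon> z) = N1 * S1 + N2 * tau_sup lam * S2"
    unfolding C1 by (rule enn2real_ennreal)
  have "norm (residual T z k)
      \<le> sqrt (((dist_fix T (z 0))\<^sup>2 + enn2real (C1 T lam \<epsilon> z)) / (tau_inf lam * real (k + 1)))" for k
    unfolding C1_real S1_def S2_def dist[symmetric]
    using residual_rate[OF assms(1) p assms(3,4) sum1 assms(7) N1 N2 tau(1,2,3)] .
  moreover have "C1 T lam \<epsilon> z < \<infinity>"
    unfolding C1 by simp
  ultimately show ?thesis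
    by blast
qed

end
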